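(* For every integer $k\geq 3$ and every $3$-dimensional brick $B$, there exists a $k$-piercing brick partition of $B$ consisting of exactly $12k-15$ bricks. In other words, $p(3,k)\leq 12k-15$.
   Context: A $d$-dimensional brick is a set $I_1\times\cdots\times I_d\subset\mathbb{R}^d$ where each $I_i=[a_i,b_i]$ is a closed bounded interval with $a_i<b_i$. A brick partition of a $d$-dimensional brick $B$ is a finite collection $\{B_1,\ldots,B_m\}$ of $d$-dimensional bricks whose union is $B$ and whose interiors are pairwise disjoint (the parts may share boundary points, but no interior points). Its size is the number $m$ of bricks. A brick partition $\{B_1,\ldots,B_m\}$ of $B$ is $k$-piercing if every line that is parallel to one of the coordinate axes and meets $B$ (including lines meeting $B$ only in its boundary) intersects at least $k$ distinct bricks $B_i$; here the bricks are closed sets, so touching a brick in a boundary point counts as intersecting it. $p(d,k)$ denotes the minimum size of a $k$-piercing brick partition of a $d$-dimensional brick (by rescaling the coordinates and translating, this does not depend on the choice of the brick). *)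

theory Defs
  imports "HOL-Analysis.Analysis"
begin

definition brick :: "(real ^ 'n) set \<Rightarrow> bool" where
  "brick B \<longleftrightarrow> (\<exists>a b. (\<forall>i. a $ i < b $ i) \<and> B = cbox a b)"

(* division_of supplies finiteness, disjoint interiors and union B, but it also
   admits degenerate boxes, which the second conjunct excludes. *)
definition brick_partition :: "(real ^ 'n) set set \<Rightarrow> (real ^ 'n) set \<Rightarrow> bool" where
  "brick_partition P B \<longleftrightarrow> P division_of B \<and> (\<forall>C\<in>P. brick C)"

definition axis_parallel_line :: "(real ^ 'n) set \<Rightarrow> bool" where
  "axis_parallel_line L \<longleftrightarrow> (\<exists>x i. L = range (\<lambda>t. x + t *\<^sub>R axis i 1))"

definition piercing_partition :: "nat \<Rightarrow> (real ^ 'n) set set \<Rightarrow> (real ^ 'n) set \<Rightarrow> bool" where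
  "piercing_partition k P B \<longleftrightarrow> brick_partition P B \<and>
     (\<forall>L. axis_parallel_line L \<and> L \<inter> B \<noteq> {} \<longrightarrow> k \<le> card {C \<in> P. L \<inter> C \<noteq> {}})"

(* The number p(d,k), where d = CARD('n); LEAST is unspecified if no k-piercing
   partition exists. *)
definition piercing_number :: "'n::finite itself \<Rightarrow> nat \<Rightarrow> nat" where
  "piercing_number TYPE('n) k =
     (LEAST m. \<exists>(B :: (real ^ 'n) set) P. brick B \<and> piercing_partition k P B \<and> card P = m)"

end

theory Submission
  imports Defs
begin

text \<open>
  A cube can be cut into 21 boxes, one at each of the 8 corners, one in the middle of each of the 12
  edges and one core, in such a way that for every axis direction \<open>d\<close> the four boxes lying on the
  edges parallel to \<open>d\<close> project along \<open>d\<close> onto the whole opposite face. So a line in direction \<open>d\<close>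
  that meets the cube meets one of these four boxes, and it also meets a box at either end of the
  cube. The three are distinct, because a box in the middle of an edge parallel to \<open>d\<close> does not reach
  the two faces orthogonal to \<open>d\<close>, and no box reaches both.

  Cutting every edge box across its edge into \<open>n\<close> equal slices makes this work for larger numbers:
  a line in direction \<open>d\<close> that meets an edge box of direction \<open>d\<close> meets all its \<open>n\<close> slices, while the
  two end boxes, even if they are sliced themselves, contribute at least one brick each. The result
  is \<open>(n + 2)\<close>-piercing and has \<open>9 + 12 * n\<close> bricks, which for \<open>n = k - 2\<close> is \<open>12 * k - 15\<close>. The lemma
  \<open>piercing_partition_by_slicing\<close> is this slicing argument for an arbitrary brick partition with
  suitable edge bricks. A box of the cube is a tile with integer corners in a grid of 6 by 6 by 6
  cells, so that disjointness and the two covering properties \<open>tiles_cover\<close> and \<open>edge_tiles_cover\<close>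
  are finite checks; the remaining lemmas carry them over to an arbitrary brick by an affine change
  of coordinates.
\<close>

section \<open>Slicing some bricks of a brick partition\<close>

lemma brick_interior_nonempty:
  fixes C :: "(real ^ 'n) set"
  assumes "brick C"
  shows "interior C \<noteq> {}"
proof -
  obtain a b where ab: "\<forall>i. a $ i < b $ i" "C = cbox a b"
    using assms by (auto simp: brick_def)
  then have "(1 / 2) *\<^sub>R (a + b) \<in> box a b"
    by (simp add: mem_box_cart field_simps)
  then show ?thesis
    using ab by (auto simp: interior_cbox)
qed

text \<open>
  All lines in direction \<open>d\<close> are handled through this criterion: only the coordinates of a point other
  than the \<open>d\<close>-th one matter.
\<close>

lemma line_meets_iff:
  fixes C :: "(real ^ 'n) set"
  shows "range (\<lambda>t. x + t *\<^sub>R axis d 1) \<inter> C \<noteq> {} \<longleftrightarrow>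
    (\<exists>y\<in>C. \<forall>j. j \<noteq> d \<longrightarrow> y $ j = x $ j)"
proof
  assume "range (\<lambda>t. x + t *\<^sub>R axis d 1) \<inter> C \<noteq> {}"
  then show "\<exists>y\<in>C. \<forall>j. j \<noteq> d \<longrightarrow> y $ j = x $ j"
    by (fastforce simp: axis_def)
next
  assume "\<exists>y\<in>C. \<forall>j. j \<noteq> d \<longrightarrow> y $ j = x $ j"
  then obtain y where y: "y \<in> C" "\<And>j. j \<noteq> d \<Longrightarrow> y $ j = x $ j"
    by blast
  have "y = x + (y $ d - x $ d) *\<^sub>R axis d 1"
    by (auto simp: vec_eq_iff axis_def y(2))
  then show "range (\<lambda>t. x + t *\<^sub>R axis d 1) \<inter> C \<noteq> {}"
    using y(1) by blast
qed

text \<open>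
  The pieces are \<open>n\<close> slices of equal width orthogonal to \<open>d\<close>. Each has the same projection along \<open>d\<close>
  as the whole brick, so a line in direction \<open>d\<close> meets either all of them or none.
\<close>

lemma brick_slicing:
  fixes C :: "(real ^ 'n) set" and d :: 'n
  assumes "brick C" and "0 < n"
  shows "\<exists>S. brick_partition S C \<and> card S = n \<and>
    (\<forall>D\<in>S. \<forall>x\<in>C. \<exists>y\<in>D. \<forall>j. j \<noteq> d \<longrightarrow> y $ j = x $ j)"
proof -
  obtain a b where ab: "\<And>i. a $ i < b $ i" and C: "C = cbox a b"
    using assms by (auto simp: brick_def)
  define w where "w = (b $ d - a $ d) / real n"
  have w: "0 < w"
    using ab[of d] \<open>0 < n\<close> by (simp add: w_def)
  have bw: "b $ d = a $ d + real n * w"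
    using \<open>0 < n\<close> by (simp add: w_def)
  define lo where "lo m = (\<chi> i. if i = d then a $ d + real m * w else a $ i)" for m
  define hi where "hi m = (\<chi> i. if i = d then a $ d + real (Suc m) * w else b $ i)" for m
  define slice where "slice m = cbox (lo m) (hi m)" for m
  have lohi: "lo m $ i < hi m $ i" for m i
    using w ab by (simp add: lo_def hi_def)
  have slice_brick: "brick (slice m)" for m
    using lohi by (auto simp: slice_def brick_def)
  have mem: "x \<in> slice m \<longleftrightarrow> a $ d + real m * w \<le> x $ d \<and> x $ d \<le> a $ d + real (Suc m) * w \<and>
      (\<forall>i. i \<noteq> d \<longrightarrow> a $ i \<le> x $ i \<and> x $ i \<le> b $ i)" for x m
    by (auto simp: slice_def mem_box_cart lo_def hi_def)
  have mem_interior: "a $ d + real m * w < x $ d" "x $ d < a $ d + real (Suc m) * w"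
    if "x \<in> interior (slice m)" for x m
    using that[unfolded slice_def interior_cbox mem_box_cart, rule_format, of d]
    by (auto simp: lo_def hi_def)
  have disj: "interior (slice l) \<inter> interior (slice m) = {}" if "l < m" for l m
  proof -
    have "real (Suc l) * w \<le> real m * w"
      using that w by (intro mult_right_mono) auto
    then show ?thesis
      using mem_interior(2)[of _ l] mem_interior(1)[of _ m] by fastforce
  qed
  then have disj': "interior (slice l) \<inter> interior (slice m) = {}" if "l \<noteq> m" for l m
    using that by (metis Int_commute linorder_neqE_nat)
  have inj: "inj_on slice {..<n}"
    by (rule inj_onI) (metis Int_absorb brick_interior_nonempty disj' slice_brick)
  have sub: "slice m \<subseteq> C" if "m < n" for m
  proof
    fix x assume "x \<in> slice m"
    moreover have "real (Suc m) * w \<le> real n * w"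
      using that w by (intro mult_right_mono) auto
    moreover have "0 \<le> real m * w"
      using w by simp
    ultimately have "a $ d \<le> x $ d" "x $ d \<le> b $ d"
      "\<forall>i. i \<noteq> d \<longrightarrow> a $ i \<le> x $ i \<and> x $ i \<le> b $ i"
      unfolding mem bw by (linarith, linarith, blast)
    then show "x \<in> C"
      unfolding C mem_box_cart by metis
  qed
  have cover: "\<exists>m<n. x \<in> slice m" if "x \<in> C" for x
  proof -
    have xb: "a $ i \<le> x $ i" "x $ i \<le> b $ i" for i
      using that by (auto simp: C mem_box_cart)
    define t where "t = (x $ d - a $ d) / w"
    have xt: "x $ d = a $ d + t * w"
      using w by (simp add: t_def)
    have t: "0 \<le> t" "t \<le> real n"
      using xb[of d] w bw by (auto simp: t_def field_simps)
    \<comment> \<open>A point of the far face belongs to the last slice, although there \<open>t\<close> has floor \<open>n\<close>.\<close>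
    obtain m where m: "m < n" "real m \<le> t" "t \<le> real (Suc m)"
    proof (cases "t = real n")
      case True
      then show ?thesis
        using that[of "n - 1"] \<open>0 < n\<close> by simp
    next
      case False
      then show ?thesis
        using that[of "nat \<lfloor>t\<rfloor>"] t by linarith
    qed
    then have "real m * w \<le> t * w" "t * w \<le> real (Suc m) * w"
      using w by (auto intro!: mult_right_mono)
    then show ?thesis
      using m(1) xb xt by (auto simp: mem)
  qed
  have part: "brick_partition (slice ` {..<n}) C"
    unfolding brick_partition_def division_of_def
  proof (intro conjI ballI impI)
    fix K assume "K \<in> slice ` {..<n}"
    then obtain m where m: "m < n" "K = slice m"
      by auto
    show "K \<subseteq> C" "brick K"
      using m sub slice_brick by auto
    show "K \<noteq> {}"
      using brick_interior_nonempty[OF slice_brick[of m]] m interior_subset by fastforce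
    show "\<exists>a b. K = cbox a b"
      using m by (auto simp: slice_def)
  next
    fix K K' assume "K \<in> slice ` {..<n}" "K' \<in> slice ` {..<n}" "K \<noteq> K'"
    then show "interior K \<inter> interior K' = {}"
      using disj' by (metis imageE)
  next
    show "\<Union> (slice ` {..<n}) = C"
      using sub cover by blast
  qed simp
  have "\<exists>y\<in>D. \<forall>j. j \<noteq> d \<longrightarrow> y $ j = x $ j" if "D \<in> slice ` {..<n}" "x \<in> C" for D x
  proof -
    obtain m where m: "D = slice m"
      using \<open>D \<in> slice ` {..<n}\<close> by auto
    have "(\<chi> i. if i = d then a $ d + real m * w else x $ i) \<in> D"
      using that(2) w by (auto simp: m mem C mem_box_cart)
    then show ?thesis
      by (rule bexI[rotated]) simp
  qed
  then show ?thesis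
    using part card_image[OF inj] by (intro exI[of _ "slice ` {..<n}"]) auto
qed

text \<open>
  Bricks have nonempty interior, so the partitions of two different bricks have no member in
  common. This makes the sizes add up, and it lets bricks that come from different \<open>C\<close> be counted as
  different below.
\<close>

lemma brick_partition_refine:
  fixes B :: "(real ^ 'n) set"
  assumes P: "brick_partition P B" and S: "\<And>C. C \<in> P \<Longrightarrow> brick_partition (S C) C"
  shows "brick_partition (\<Union>C\<in>P. S C) B" (is ?part)
    and "\<And>C C'. C \<in> P \<Longrightarrow> C' \<in> P \<Longrightarrow> C \<noteq> C' \<Longrightarrow> S C \<inter> S C' = {}"
    and "card (\<Union>C\<in>P. S C) = (\<Sum>C\<in>P. card (S C))" (is ?card)
proof -
  have dP: "P division_of B" and dS: "\<And>C. C \<in> P \<Longrightarrow> S C division_of C"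
    using P S by (auto simp: brick_partition_def)
  have int: "interior D \<inter> interior D' = {}"
    if "C \<in> P" "C' \<in> P" "C \<noteq> C'" "D \<in> S C" "D' \<in> S C'" for C C' D D'
  proof -
    have "D \<subseteq> C" "D' \<subseteq> C'"
      using division_ofD(2)[OF dS] that by blast+
    then have "interior D \<subseteq> interior C" "interior D' \<subseteq> interior C'"
      by (auto simp: interior_mono)
    then show ?thesis
      using division_ofD(5)[OF dP] that(1-3) by blast
  qed
  show disj: "S C \<inter> S C' = {}" if "C \<in> P" "C' \<in> P" "C \<noteq> C'" for C C'
  proof (rule ccontr)
    assume "S C \<inter> S C' \<noteq> {}"
    then obtain D where D: "D \<in> S C" "D \<in> S C'"
      by blast
    then have "brick D"
      using S[OF that(1)] by (simp add: brick_partition_def)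
    then show False
      using int[OF that D] brick_interior_nonempty by blast
  qed
  have fin: "finite P" "\<And>C. C \<in> P \<Longrightarrow> finite (S C)"
    using division_of_finite dP dS by blast+
  show ?card
    using fin disj by (intro card_UN_disjoint) auto
  have "(\<Union>C\<in>P. S C) division_of \<Union> (\<Union>C\<in>P. S C)"
  proof (rule division_ofI)
    show "finite (\<Union>C\<in>P. S C)"
      using fin by blast
    fix K assume "K \<in> (\<Union>C\<in>P. S C)"
    then obtain C where C: "C \<in> P" "K \<in> S C"
      by blast
    show "K \<subseteq> \<Union> (\<Union>C\<in>P. S C)"
      using C by blast
    show "K \<noteq> {}" "\<exists>a b. K = cbox a b"
      using division_ofD(3,4)[OF dS[OF C(1)] C(2)] by auto
    fix K' assume "K' \<in> (\<Union>C\<in>P. S C)" "K \<noteq> K'"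
    then obtain C' where C': "C' \<in> P" "K' \<in> S C'"
      by blast
    show "interior K \<inter> interior K' = {}"
      using int[OF C(1) C'(1) _ C(2) C'(2)] division_ofD(5)[OF dS[OF C(1)] C(2)] C'(2)
        \<open>K \<noteq> K'\<close> by blast
  qed simp
  moreover have "\<Union> (\<Union>C\<in>P. S C) = (\<Union>C\<in>P. \<Union> (S C))"
    by blast
  then have "\<Union> (\<Union>C\<in>P. S C) = B"
    using division_ofD(6)[OF dP] division_ofD(6)[OF dS] by simp
  ultimately show ?part
    using S by (auto simp: brick_partition_def)
qed

text \<open>
  \<open>E d\<close> is the set of bricks to be cut into \<open>n\<close> slices orthogonal to \<open>d\<close>. A line in direction \<open>d\<close> gains
  \<open>n\<close> bricks from the brick of \<open>E d\<close> that it meets. The other two bricks on it may belong to some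
  \<open>E e\<close> with \<open>e \<noteq> d\<close>, and then only one of their slices need be met; hence \<open>n + 2\<close>.
\<close>

lemma piercing_partition_by_slicing:
  fixes B :: "(real ^ 'n) set" and E :: "'n \<Rightarrow> (real ^ 'n) set set"
  assumes P: "brick_partition P B" and E: "\<And>d. E d \<subseteq> P" and "disjoint_family E" and "0 < n"
    and lines: "\<And>d x. x \<in> B \<Longrightarrow> \<exists>C\<in>E d. \<exists>C1\<in>P. \<exists>C2\<in>P. C1 \<noteq> C \<and> C2 \<noteq> C \<and> C1 \<noteq> C2 \<and>
      (\<forall>K\<in>{C, C1, C2}. \<exists>y\<in>K. \<forall>j. j \<noteq> d \<longrightarrow> y $ j = x $ j)"
  shows "\<exists>Q. piercing_partition (n + 2) Q B \<and>
    card Q = card (P - (\<Union>d. E d)) + n * card (\<Union>d. E d)"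
proof -
  let ?E = "\<Union>d. E d"
  have brickP: "brick C" if "C \<in> P" for C
    using P that by (simp add: brick_partition_def)
  have finP: "finite P"
    using P division_of_finite by (auto simp: brick_partition_def)
  have "\<forall>C\<in>P. \<exists>S. brick_partition S C \<and> card S = (if C \<in> ?E then n else 1) \<and>
      (\<forall>d. C \<in> E d \<longrightarrow> (\<forall>D\<in>S. \<forall>x\<in>C. \<exists>y\<in>D. \<forall>j. j \<noteq> d \<longrightarrow> y $ j = x $ j))"
  proof
    fix C
    assume C: "C \<in> P"
    show "\<exists>S. brick_partition S C \<and> card S = (if C \<in> ?E then n else 1) \<and>
      (\<forall>d. C \<in> E d \<longrightarrow> (\<forall>D\<in>S. \<forall>x\<in>C. \<exists>y\<in>D. \<forall>j. j \<noteq> d \<longrightarrow> y $ j = x $ j))"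
    proof (cases "C \<in> ?E")
      case True
      then obtain d where d: "C \<in> E d"
        by blast
      then have unique: "C \<in> E d' \<longleftrightarrow> d' = d" for d'
        using disjoint_family_onD[OF \<open>disjoint_family E\<close>, of d d'] by blast
      obtain S where "brick_partition S C" "card S = n"
        "\<forall>D\<in>S. \<forall>x\<in>C. \<exists>y\<in>D. \<forall>j. j \<noteq> d \<longrightarrow> y $ j = x $ j"
        using brick_slicing[OF brickP[OF C] \<open>0 < n\<close>, of d] by blast
      then show ?thesis
        using True by (intro exI[of _ S]) (simp add: unique)
    next
      case False
      have "{C} division_of C"
        using brickP[OF C] brick_interior_nonempty[OF brickP[OF C]]
        by (fastforce simp: brick_def intro!: division_of_self)
      then have "brick_partition {C} C"
        using brickP[OF C] by (simp add: brick_partition_def)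
      then show ?thesis
        using False by (intro exI[of _ "{C}"]) auto
    qed
  qed
  from bchoice[OF this] obtain S where S: "\<forall>C\<in>P. brick_partition (S C) C \<and>
      card (S C) = (if C \<in> ?E then n else 1) \<and>
      (\<forall>d. C \<in> E d \<longrightarrow> (\<forall>D\<in>S C. \<forall>x\<in>C. \<exists>y\<in>D. \<forall>j. j \<noteq> d \<longrightarrow> y $ j = x $ j))"
    by blast
  then have part: "brick_partition (S C) C" and cardS: "card (S C) = (if C \<in> ?E then n else 1)"
    if "C \<in> P" for C
    using that by blast+
  let ?Q = "\<Union>C\<in>P. S C"
  have partQ: "brick_partition ?Q B"
    by (rule brick_partition_refine(1)[OF P part])
  have disjoint: "S C \<inter> S C' = {}" if "C \<in> P" "C' \<in> P" "C \<noteq> C'" for C C'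
    by (rule brick_partition_refine(2)[OF P part that])
  have "card ?Q = (\<Sum>C\<in>P. if C \<in> ?E then n else 1)"
    using brick_partition_refine(3)[OF P part] cardS by simp
  also have "\<dots> = (\<Sum>C\<in>P - ?E. if C \<in> ?E then n else 1) + (\<Sum>C\<in>?E. if C \<in> ?E then n else 1)"
    using finP E by (intro sum.subset_diff) auto
  also have "\<dots> = card (P - ?E) + n * card ?E"
    by simp
  finally have card: "card ?Q = card (P - ?E) + n * card ?E" .
  have "n + 2 \<le> card {D \<in> ?Q. L \<inter> D \<noteq> {}}"
    if "axis_parallel_line L" and meets: "L \<inter> B \<noteq> {}" for L
  proof -
    obtain x0 d where L: "L = range (\<lambda>t. x0 + t *\<^sub>R axis d 1)"
      using \<open>axis_parallel_line L\<close> by (auto simp: axis_parallel_line_def)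
    have meets_iff: "L \<inter> K \<noteq> {} \<longleftrightarrow> (\<exists>y\<in>K. \<forall>j. j \<noteq> d \<longrightarrow> y $ j = x0 $ j)" for K
      unfolding L by (rule line_meets_iff)
    obtain x where x: "x \<in> B" "\<And>j. j \<noteq> d \<Longrightarrow> x $ j = x0 $ j"
      using meets meets_iff by blast
    obtain C C1 C2 where C: "C \<in> E d" "C1 \<in> P" "C2 \<in> P" "C1 \<noteq> C" "C2 \<noteq> C" "C1 \<noteq> C2"
      and "\<forall>K\<in>{C, C1, C2}. \<exists>y\<in>K. \<forall>j. j \<noteq> d \<longrightarrow> y $ j = x $ j"
      using lines[OF x(1), of d] by blast
    then have meetsC: "\<exists>y\<in>C. \<forall>j. j \<noteq> d \<longrightarrow> y $ j = x0 $ j" "L \<inter> C1 \<noteq> {}" "L \<inter> C2 \<noteq> {}"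
      unfolding meets_iff using x(2) by simp_all
    have CP: "C \<in> P"
      using C(1) E by blast
    have "\<exists>D\<in>S K. L \<inter> D \<noteq> {}" if "K \<in> P" "L \<inter> K \<noteq> {}" for K
    proof -
      have "\<Union> (S K) = K"
        using part[OF that(1)] division_ofD(6) by (auto simp: brick_partition_def)
      then show ?thesis
        using that(2) by blast
    qed
    then obtain D1 D2 where D: "D1 \<in> S C1" "D2 \<in> S C2" "L \<inter> D1 \<noteq> {}" "L \<inter> D2 \<noteq> {}"
      using C(2,3) meetsC by meson
    have "L \<inter> D \<noteq> {}" if "D \<in> S C" for D
    proof -
      obtain z where z: "z \<in> C" "\<And>j. j \<noteq> d \<Longrightarrow> z $ j = x0 $ j"
        using meetsC(1) by blast
      then show ?thesis
        unfolding meets_iff using S CP C(1) that z by (metis (no_types, lifting))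
    qed
    then have sub: "insert D1 (insert D2 (S C)) \<subseteq> {D \<in> ?Q. L \<inter> D \<noteq> {}}"
      using D C CP by blast
    have fresh: "D1 \<notin> S C" "D2 \<notin> S C" "D1 \<noteq> D2"
      using disjoint[OF C(2) CP C(4)] disjoint[OF C(3) CP C(5)] disjoint[OF C(2,3) C(6)] D(1,2)
      by blast+
    have "card (S C) = n"
      using cardS[OF CP] C(1) by auto
    moreover have "finite (S C)"
      using \<open>card (S C) = n\<close> \<open>0 < n\<close> card_gt_0_iff by metis
    ultimately have "card (insert D1 (insert D2 (S C))) = n + 2"
      using fresh by simp
    moreover have "finite ?Q"
      using partQ division_of_finite unfolding brick_partition_def by blast
    then have "finite {D \<in> ?Q. L \<inter> D \<noteq> {}}"
      by (rule rev_finite_subset) blast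
    ultimately show ?thesis
      using card_mono[OF _ sub] by metis
  qed
  then show ?thesis
    using partQ card by (intro exI[of _ ?Q]) (auto simp: piercing_partition_def)
qed

section \<open>A tiling of the grid cube by 21 boxes\<close>

text \<open>
  A tile is the product of three intervals, given by their end points. The grid cube is
  \<open>[0, 6]\<close> to the third power. The tiling is invariant under cyclic rotation of the coordinates and
  under reflection in the centre of the cube. These symmetries generate a group of order 6, which
  acts freely on the 12 edges and on the corners other than \<open>(0, 0, 0)\<close> and \<open>(6, 6, 6)\<close>. The tiling
  therefore consists of three orbits of size 6, two of them edge tiles and one of them corner tiles,
  the two special corner cubes, and the fixed core.
\<close>

type_synonym tile = "(int \<times> int) \<times> (int \<times> int) \<times> (int \<times> int)"

fun rotate_tile :: "tile \<Rightarrow> tile" where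
  "rotate_tile (I, J, K) = (K, I, J)"

fun flip :: "int \<times> int \<Rightarrow> int \<times> int" where
  "flip (p, q) = (6 - q, 6 - p)"

fun mirror_tile :: "tile \<Rightarrow> tile" where
  "mirror_tile (I, J, K) = (flip I, flip J, flip K)"

text \<open>
  The tiles in the middle of the four edges parallel to the third axis. Their projections to the first
  two coordinates are \<open>[0,4] \<times> [0,2]\<close>, \<open>[0,3] \<times> [2,6]\<close>, \<open>[2,6] \<times> [4,6]\<close> and \<open>[3,6] \<times> [0,4]\<close>. These
  overlap and together cover the square; the overlaps do no harm since the tiles lie at different
  heights.
\<close>

definition edge_tiles3 :: "tile list" where
  "edge_tiles3 = (let ts = [((0,4),(0,2),(2,3)), ((0,3),(2,6),(4,5))] in ts @ map mirror_tile ts)"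

definition edge_tiles1 :: "tile list" where
  "edge_tiles1 = map rotate_tile edge_tiles3"

definition edge_tiles2 :: "tile list" where
  "edge_tiles2 = map rotate_tile edge_tiles1"

text \<open>
  The tiles that stay uncut: six corner tiles, the core, and the two corner cubes on the axis of
  rotation.
\<close>

definition solid_tiles :: "tile list" where
  "solid_tiles =
    (let t = ((0,4),(0,1),(3,6)); ts = [t, rotate_tile t, rotate_tile (rotate_tile t)]
     in ts @ map mirror_tile ts @
       [((0,2),(0,2),(0,2)), ((2,4),(2,4),(2,4)), ((4,6),(4,6),(4,6))])"

definition tiles :: "tile list" where
  "tiles = solid_tiles @ edge_tiles1 @ edge_tiles2 @ edge_tiles3"

definition edge_tiles :: "3 \<Rightarrow> tile list" where
  "edge_tiles d = (if d = 1 then edge_tiles1 else if d = 2 then edge_tiles2 else edge_tiles3)"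

definition side :: "tile \<Rightarrow> 3 \<Rightarrow> int \<times> int" where
  "side t d = (if d = 1 then fst t else if d = 2 then fst (snd t) else snd (snd t))"

lemma side_simps [simp]: "side (I, J, K) 1 = I" "side (I, J, K) 2 = J" "side (I, J, K) 3 = K"
  by (simp_all add: side_def)

lemmas tile_defs = edge_tiles1_def edge_tiles2_def edge_tiles3_def solid_tiles_def tiles_def

lemma tiles_explicit:
  "tiles = [((0,4),(0,1),(3,6)), ((3,6),(0,4),(0,1)), ((0,1),(3,6),(0,4)),
    ((2,6),(5,6),(0,3)), ((0,3),(2,6),(5,6)), ((5,6),(0,3),(2,6)),
    ((0,2),(0,2),(0,2)), ((2,4),(2,4),(2,4)), ((4,6),(4,6),(4,6)),
    ((2,3),(0,4),(0,2)), ((4,5),(0,3),(2,6)), ((3,4),(2,6),(4,6)), ((1,2),(3,6),(0,4)),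
    ((0,2),(2,3),(0,4)), ((2,6),(4,5),(0,3)), ((4,6),(3,4),(2,6)), ((0,4),(1,2),(3,6)),
    ((0,4),(0,2),(2,3)), ((0,3),(2,6),(4,5)), ((2,6),(4,6),(3,4)), ((3,6),(0,4),(1,2))]"
  by (simp add: tile_defs Let_def)

lemma distinct_tiles: "distinct tiles" "length tiles = 21"
  by (simp_all add: tiles_explicit)

lemma tile_separated:
  assumes "s \<in> set tiles" "t \<in> set tiles" "s \<noteq> t"
  shows "\<exists>i. snd (side s i) \<le> fst (side t i) \<or> snd (side t i) \<le> fst (side s i)"
proof -
  have "\<forall>s\<in>set tiles. \<forall>t\<in>set tiles. s \<noteq> t \<longrightarrow>
      snd (fst s) \<le> fst (fst t) \<or> snd (fst t) \<le> fst (fst s) \<or>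
      snd (fst (snd s)) \<le> fst (fst (snd t)) \<or> snd (fst (snd t)) \<le> fst (fst (snd s)) \<or>
      snd (snd (snd s)) \<le> fst (snd (snd t)) \<or> snd (snd (snd t)) \<le> fst (snd (snd s))"
    by code_simp
  from this[rule_format, OF assms]
  have "\<exists>i\<in>{1, 2, 3}. snd (side s i) \<le> fst (side t i) \<or> snd (side t i) \<le> fst (side s i)"
    by (simp add: side_def)
  then show ?thesis
    by blast
qed

text \<open>
  The last inequality says that no tile reaches two opposite faces, which makes the tiles at the two
  ends of a line different.
\<close>

lemma tile_shape:
  assumes "t \<in> set tiles"
  shows "0 \<le> fst (side t i)" "fst (side t i) < snd (side t i)" "snd (side t i) \<le> 6"
    "0 < fst (side t i) \<or> snd (side t i) < 6"
  using assms exhaust_3[of i] by (auto simp: tiles_explicit)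

lemma tiles_cover:
  assumes "\<forall>i. c i \<in> {0..5}"
  shows "\<exists>t\<in>set tiles. \<forall>i. fst (side t i) \<le> c i \<and> c i < snd (side t i)"
proof -
  \<comment> \<open>an exhaustive check of the 216 unit cells\<close>
  have "\<forall>x\<in>set [0..5]. \<forall>y\<in>set [0..5]. \<forall>z\<in>set [0..5]. \<exists>(I, J, K)\<in>set tiles.
      fst I \<le> x \<and> x < snd I \<and> fst J \<le> y \<and> y < snd J \<and> fst K \<le> z \<and> z < snd K"
    by code_simp
  moreover have "c i \<in> set [0..5]" for i
    using assms by simp
  ultimately obtain I J K where "(I, J, K) \<in> set tiles"
    "fst I \<le> c 1 \<and> c 1 < snd I \<and> fst J \<le> c 2 \<and> c 2 < snd J \<and> fst K \<le> c 3 \<and> c 3 < snd K"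
    by fast
  then show ?thesis
    by (intro bexI[of _ "(I, J, K)"]) (auto simp: forall_3)
qed

text \<open>
  This is the property the tiling was designed for: the four edge tiles of direction \<open>d\<close> project onto
  the whole square, checked on its 36 unit cells for each direction.
\<close>

lemma edge_tiles_cover:
  assumes "\<forall>i. c i \<in> {0..5}"
  shows "\<exists>t\<in>set (edge_tiles d). \<forall>i. i \<noteq> d \<longrightarrow> fst (side t i) \<le> c i \<and> c i < snd (side t i)"
proof -
  have c: "c i \<in> set [0..5]" for i
    using assms by simp
  have cover1: "\<forall>y\<in>set [0..5]. \<forall>z\<in>set [0..5]. \<exists>(I, J, K)\<in>set edge_tiles1.
      fst J \<le> y \<and> y < snd J \<and> fst K \<le> z \<and> z < snd K"
    by code_simp
  have cover2: "\<forall>x\<in>set [0..5]. \<forall>z\<in>set [0..5]. \<exists>(I, J, K)\<in>set edge_tiles2.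
      fst I \<le> x \<and> x < snd I \<and> fst K \<le> z \<and> z < snd K"
    by code_simp
  have cover3: "\<forall>x\<in>set [0..5]. \<forall>y\<in>set [0..5]. \<exists>(I, J, K)\<in>set edge_tiles3.
      fst I \<le> x \<and> x < snd I \<and> fst J \<le> y \<and> y < snd J"
    by code_simp
  consider "d = 1" | "d = 2" | "d = 3"
    using exhaust_3 by blast
  then show ?thesis
  proof cases
    case 1
    obtain I J K where "(I, J, K) \<in> set edge_tiles1"
      "fst J \<le> c 2 \<and> c 2 < snd J \<and> fst K \<le> c 3 \<and> c 3 < snd K"
      using cover1 c by fast
    then show ?thesis
      by (intro bexI[of _ "(I, J, K)"]) (auto simp: forall_3 edge_tiles_def 1)
  next
    case 2
    obtain I J K where "(I, J, K) \<in> set edge_tiles2"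
      "fst I \<le> c 1 \<and> c 1 < snd I \<and> fst K \<le> c 3 \<and> c 3 < snd K"
      using cover2 c by fast
    then show ?thesis
      by (intro bexI[of _ "(I, J, K)"]) (auto simp: forall_3 edge_tiles_def 2)
  next
    case 3
    obtain I J K where "(I, J, K) \<in> set edge_tiles3"
      "fst I \<le> c 1 \<and> c 1 < snd I \<and> fst J \<le> c 2 \<and> c 2 < snd J"
      using cover3 c by fast
    then show ?thesis
      by (intro bexI[of _ "(I, J, K)"]) (auto simp: forall_3 edge_tiles_def 3)
  qed
qed

lemma edge_tiles_subset: "set (edge_tiles d) \<subseteq> set tiles"
  by (auto simp: edge_tiles_def tiles_def)

text \<open>
  An edge tile stays away from both ends of its edge, so it differs from the tiles that a line in
  its direction meets at the boundary.
\<close>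

lemma edge_tile_inner:
  assumes "t \<in> set (edge_tiles d)"
  shows "0 < fst (side t d)" "snd (side t d) < 6"
  using assms exhaust_3[of d] by (auto simp: edge_tiles_def tile_defs Let_def)

lemma edge_tiles_disjoint:
  assumes "d \<noteq> e"
  shows "set (edge_tiles d) \<inter> set (edge_tiles e) = {}"
  using distinct_tiles(1) assms exhaust_3[of d] exhaust_3[of e]
  by (auto simp: edge_tiles_def tiles_def)

lemma card_edge_tiles: "card (\<Union>d. set (edge_tiles d)) = 12"
proof -
  have "(\<Union>d. set (edge_tiles d)) = set (edge_tiles1 @ edge_tiles2 @ edge_tiles3)"
    unfolding UNIV_3 by (simp add: edge_tiles_def Un_assoc)
  also have "card \<dots> = length (edge_tiles1 @ edge_tiles2 @ edge_tiles3)"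
    using distinct_tiles(1) by (intro distinct_card) (simp add: tiles_def)
  also have "\<dots> = 12"
    by (simp add: tile_defs Let_def)
  finally show ?thesis .
qed

section \<open>Placing the tiling in a brick\<close>

definition grid_point :: "real ^ 3 \<Rightarrow> real ^ 3 \<Rightarrow> (3 \<Rightarrow> int) \<Rightarrow> real ^ 3" where
  "grid_point a b v = (\<chi> i. a $ i + real_of_int (v i) / 6 * (b $ i - a $ i))"

definition tile_brick :: "real ^ 3 \<Rightarrow> real ^ 3 \<Rightarrow> tile \<Rightarrow> (real ^ 3) set" where
  "tile_brick a b t =
    cbox (grid_point a b (\<lambda>i. fst (side t i))) (grid_point a b (\<lambda>i. snd (side t i)))"

text \<open>
  The inverse of the affine map that sends the grid cube to \<open>cbox a b\<close>. In these coordinates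
  membership in a tile brick or in its interior compares a real number with the integer end points.
\<close>

definition grid_coord :: "real ^ 3 \<Rightarrow> real ^ 3 \<Rightarrow> real ^ 3 \<Rightarrow> 3 \<Rightarrow> real" where
  "grid_coord a b x i = 6 * (x $ i - a $ i) / (b $ i - a $ i)"

lemma grid_point_compare:
  assumes "a $ i < b $ i"
  shows "grid_point a b v $ i \<le> x $ i \<longleftrightarrow> of_int (v i) \<le> grid_coord a b x i"
    and "x $ i \<le> grid_point a b v $ i \<longleftrightarrow> grid_coord a b x i \<le> of_int (v i)"
    and "grid_point a b v $ i < x $ i \<longleftrightarrow> of_int (v i) < grid_coord a b x i"
    and "x $ i < grid_point a b v $ i \<longleftrightarrow> grid_coord a b x i < of_int (v i)"
proof -
  have "grid_coord a b x i * (b $ i - a $ i) = 6 * (x $ i - a $ i)"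
    using assms by (simp add: grid_coord_def)
  then have "x $ i = a $ i + grid_coord a b x i / 6 * (b $ i - a $ i)"
    by (simp add: diff_divide_distrib)
  moreover have "0 < b $ i - a $ i"
    using assms by simp
  ultimately show "grid_point a b v $ i \<le> x $ i \<longleftrightarrow> of_int (v i) \<le> grid_coord a b x i"
    "x $ i \<le> grid_point a b v $ i \<longleftrightarrow> grid_coord a b x i \<le> of_int (v i)"
    "grid_point a b v $ i < x $ i \<longleftrightarrow> of_int (v i) < grid_coord a b x i"
    "x $ i < grid_point a b v $ i \<longleftrightarrow> grid_coord a b x i < of_int (v i)"
    by (simp_all add: grid_point_def divide_le_cancel divide_less_cancel mult_le_cancel_right mult_less_cancel_right)
qed

text \<open>
  Both inequalities are weak, because at \<open>u = 6\<close> the cell is the last one, which has 6 as its upper end.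
\<close>

lemma grid_cell:
  fixes u :: real
  assumes "0 \<le> u" "u \<le> 6"
  shows "\<exists>c\<in>{0..5}. of_int c \<le> u \<and> u \<le> of_int (c + 1)"
proof (cases "u = 6")
  case True
  then show ?thesis
    by (intro bexI[of _ 5]) auto
next
  case False
  show ?thesis
  proof (intro bexI conjI)
    show "real_of_int \<lfloor>u\<rfloor> \<le> u" "u \<le> real_of_int (\<lfloor>u\<rfloor> + 1)"
      by linarith+
    show "\<lfloor>u\<rfloor> \<in> {0..5}"
      using False assms by (auto simp: floor_less_iff le_floor_iff intro: floor_le_iff[THEN iffD2])
  qed
qed

context
  fixes a b :: "real ^ 3"
  assumes ab: "\<And>i. a $ i < b $ i"
begin

lemma mem_tile_brick:
  "x \<in> tile_brick a b t \<longleftrightarrow>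
    (\<forall>i. of_int (fst (side t i)) \<le> grid_coord a b x i \<and> grid_coord a b x i \<le> of_int (snd (side t i)))"
  by (simp add: tile_brick_def mem_box_cart grid_point_compare[OF ab])

lemma mem_interior_tile_brick:
  "x \<in> interior (tile_brick a b t) \<longleftrightarrow>
    (\<forall>i. of_int (fst (side t i)) < grid_coord a b x i \<and> grid_coord a b x i < of_int (snd (side t i)))"
  by (simp add: tile_brick_def interior_cbox mem_box_cart grid_point_compare[OF ab])

lemma mem_cbox_iff_grid_coord:
  "x \<in> cbox a b \<longleftrightarrow> (\<forall>i. 0 \<le> grid_coord a b x i \<and> grid_coord a b x i \<le> 6)"
proof -
  have "a $ i \<le> x $ i \<longleftrightarrow> 0 \<le> grid_coord a b x i" "x $ i \<le> b $ i \<longleftrightarrow> grid_coord a b x i \<le> 6" for i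
    using ab[of i] by (auto simp: grid_coord_def field_simps zero_le_divide_iff)
  then show ?thesis
    by (simp add: mem_box_cart)
qed

lemma grid_coord_cells:
  assumes "x \<in> cbox a b"
  shows "\<exists>c. \<forall>i. c i \<in> {0..5} \<and> of_int (c i) \<le> grid_coord a b x i \<and>
    grid_coord a b x i \<le> of_int (c i + 1)"
proof -
  have "\<forall>i. \<exists>c. c \<in> {0..5} \<and> of_int c \<le> grid_coord a b x i \<and> grid_coord a b x i \<le> of_int (c + 1)"
    using assms grid_cell unfolding mem_cbox_iff_grid_coord by blast
  then show ?thesis
    by (rule choice)
qed

lemma brick_tile_brick:
  assumes "t \<in> set tiles"
  shows "brick (tile_brick a b t)"
  unfolding brick_def tile_brick_def
proof (intro exI conjI allI)
  fix i
  have "real_of_int (fst (side t i)) / 6 * (b $ i - a $ i) < real_of_int (snd (side t i)) / 6 * (b $ i - a $ i)"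
    using tile_shape(2)[OF assms, of i] ab[of i] by (intro mult_strict_right_mono) auto
  then show "grid_point a b (\<lambda>i. fst (side t i)) $ i < grid_point a b (\<lambda>i. snd (side t i)) $ i"
    by (simp add: grid_point_def)
qed simp

lemma interior_tile_bricks_disjoint:
  assumes "s \<in> set tiles" "t \<in> set tiles" "s \<noteq> t"
  shows "interior (tile_brick a b s) \<inter> interior (tile_brick a b t) = {}"
proof -
  obtain i where "snd (side s i) \<le> fst (side t i) \<or> snd (side t i) \<le> fst (side s i)"
    using tile_separated[OF assms] by blast
  then have i: "real_of_int (snd (side s i)) \<le> of_int (fst (side t i)) \<or>
      real_of_int (snd (side t i)) \<le> of_int (fst (side s i))"
    by simp
  show ?thesis
  proof (intro equals0I, elim IntE)
    fix x
    assume "x \<in> interior (tile_brick a b s)" "x \<in> interior (tile_brick a b t)"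
    then show False
      unfolding mem_interior_tile_brick using i by (smt (verit))
  qed
qed

lemma inj_on_tile_brick: "inj_on (tile_brick a b) (set tiles)"
  by (rule inj_onI)
    (metis Int_absorb brick_interior_nonempty brick_tile_brick interior_tile_bricks_disjoint)

lemma tile_bricks_cover:
  assumes "x \<in> cbox a b"
  shows "\<exists>t\<in>set tiles. x \<in> tile_brick a b t"
proof -
  obtain c where c: "\<And>i. c i \<in> {0..5}"
    "\<And>i. of_int (c i) \<le> grid_coord a b x i" "\<And>i. grid_coord a b x i \<le> of_int (c i + 1)"
    using grid_coord_cells[OF assms] by blast
  then obtain t where t: "t \<in> set tiles" "\<And>i. fst (side t i) \<le> c i" "\<And>i. c i + 1 \<le> snd (side t i)"
    using tiles_cover[of c] by (auto simp: add1_zle_eq)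
  then have "real_of_int (fst (side t i)) \<le> of_int (c i)" "real_of_int (c i + 1) \<le> of_int (snd (side t i))" for i
    by (simp_all only: of_int_le_iff)
  then have "x \<in> tile_brick a b t"
    unfolding mem_tile_brick using c(2,3) order_trans by blast
  then show ?thesis
    using t(1) by blast
qed

lemma brick_partition_tiles: "brick_partition (tile_brick a b ` set tiles) (cbox a b)"
  unfolding brick_partition_def division_of_def
proof (intro conjI ballI impI)
  have sub: "tile_brick a b t \<subseteq> cbox a b" if "t \<in> set tiles" for t
  proof
    fix x assume x: "x \<in> tile_brick a b t"
    have "0 \<le> real_of_int (fst (side t i))" "real_of_int (snd (side t i)) \<le> 6" for i
      using tile_shape(1,3)[OF that, of i] by simp_all
    then show "x \<in> cbox a b"
      using x unfolding mem_tile_brick mem_cbox_iff_grid_coord by (meson order_trans)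
  qed
  show "\<Union> (tile_brick a b ` set tiles) = cbox a b"
    using sub tile_bricks_cover by blast
  fix C assume "C \<in> tile_brick a b ` set tiles"
  then obtain t where t: "t \<in> set tiles" "C = tile_brick a b t"
    by blast
  show "C \<subseteq> cbox a b" "brick C"
    using t sub brick_tile_brick by auto
  show "C \<noteq> {}"
    using brick_interior_nonempty[OF \<open>brick C\<close>] by auto
  show "\<exists>l u. C = cbox l u"
    using t by (auto simp: tile_brick_def)
  fix D assume D: "D \<in> tile_brick a b ` set tiles" "C \<noteq> D"
  then obtain s where s: "s \<in> set tiles" "D = tile_brick a b s"
    by blast
  then show "interior C \<inter> interior D = {}"
    using t D(2) interior_tile_bricks_disjoint[of t s] by blast
qed simp

text \<open>
  The line crosses the two faces of the brick orthogonal to its direction; the tiles that cover these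
  crossing points begin at 0 and end at 6, respectively.
\<close>

lemma line_meets_end_tiles:
  assumes "x \<in> cbox a b"
  shows "\<exists>s\<in>set tiles. \<exists>t\<in>set tiles. fst (side s d) = 0 \<and> snd (side t d) = 6 \<and>
    (\<exists>y\<in>tile_brick a b s. \<forall>j. j \<noteq> d \<longrightarrow> y $ j = x $ j) \<and>
    (\<exists>y\<in>tile_brick a b t. \<forall>j. j \<noteq> d \<longrightarrow> y $ j = x $ j)"
proof -
  define y where "y = (\<chi> i. if i = d then a $ i else x $ i)"
  define z where "z = (\<chi> i. if i = d then b $ i else x $ i)"
  have "y \<in> cbox a b" "z \<in> cbox a b"
    using assms ab by (auto simp: mem_box_cart y_def z_def less_imp_le)
  then obtain s t where s: "s \<in> set tiles" "y \<in> tile_brick a b s"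
    and t: "t \<in> set tiles" "z \<in> tile_brick a b t"
    using tile_bricks_cover by meson
  have "grid_coord a b y d = 0" "grid_coord a b z d = 6"
    using ab[of d] by (simp_all add: grid_coord_def y_def z_def field_simps)
  then have "fst (side s d) \<le> 0" "6 \<le> snd (side t d)"
    using s(2) t(2) unfolding mem_tile_brick by (metis of_int_le_0_iff, metis of_int_le_iff of_int_numeral)
  then have "fst (side s d) = 0" "snd (side t d) = 6"
    using tile_shape(1)[OF s(1), of d] tile_shape(3)[OF t(1), of d] by simp_all
  moreover have "\<forall>j. j \<noteq> d \<longrightarrow> y $ j = x $ j" "\<forall>j. j \<noteq> d \<longrightarrow> z $ j = x $ j"
    by (simp_all add: y_def z_def)
  ultimately show ?thesis
    using s t by blast
qed

text \<open>
  The line passes through some column of unit cells, which by \<open>edge_tiles_cover\<close> lies in the projection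
  of an edge tile.
\<close>

lemma line_meets_edge_tile:
  assumes "x \<in> cbox a b"
  shows "\<exists>t\<in>set (edge_tiles d). \<exists>y\<in>tile_brick a b t. \<forall>j. j \<noteq> d \<longrightarrow> y $ j = x $ j"
proof -
  obtain c where c: "\<And>i. c i \<in> {0..5}"
    "\<And>i. of_int (c i) \<le> grid_coord a b x i" "\<And>i. grid_coord a b x i \<le> of_int (c i + 1)"
    using grid_coord_cells[OF assms] by blast
  then obtain t where t: "t \<in> set (edge_tiles d)"
    "\<And>i. i \<noteq> d \<Longrightarrow> fst (side t i) \<le> c i" "\<And>i. i \<noteq> d \<Longrightarrow> c i + 1 \<le> snd (side t i)"
    using edge_tiles_cover[of c d] by (auto simp: add1_zle_eq)
  define y where "y = (\<chi> i. if i = d then grid_point a b (\<lambda>i. fst (side t i)) $ i else x $ i)"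
  have yd: "grid_coord a b y d = of_int (fst (side t d))"
    using ab[of d] by (simp add: y_def grid_coord_def grid_point_def)
  have y: "grid_coord a b y i = grid_coord a b x i" if "i \<noteq> d" for i
    using that by (simp add: y_def grid_coord_def)
  have "fst (side t d) < snd (side t d)"
    using tile_shape(2) t(1) edge_tiles_subset by blast
  moreover have "of_int (fst (side t i)) \<le> grid_coord a b x i" "grid_coord a b x i \<le> of_int (snd (side t i))"
    if "i \<noteq> d" for i
    using t(2,3)[OF that] c(2,3)[of i] by linarith+
  ultimately have "y \<in> tile_brick a b t"
    unfolding mem_tile_brick using yd y by (metis less_imp_le of_int_le_iff order_refl)
  then show ?thesis
    using t(1) by (intro bexI[of _ t] bexI[of _ y]) (auto simp: y_def)
qed

lemma piercing_partition_cbox: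
  assumes "0 < n"
  shows "\<exists>Q. piercing_partition (n + 2) Q (cbox a b) \<and> card Q = 9 + 12 * n"
proof -
  let ?f = "tile_brick a b"
  let ?P = "?f ` set tiles" and ?E = "\<lambda>d. ?f ` set (edge_tiles d)"
  have "disjoint_family ?E"
    unfolding disjoint_family_on_def
    using edge_tiles_disjoint edge_tiles_subset inj_on_image_Int[OF inj_on_tile_brick]
    by (metis image_empty)
  moreover have "\<exists>C\<in>?E d. \<exists>C1\<in>?P. \<exists>C2\<in>?P. C1 \<noteq> C \<and> C2 \<noteq> C \<and> C1 \<noteq> C2 \<and>
      (\<forall>K\<in>{C, C1, C2}. \<exists>y\<in>K. \<forall>j. j \<noteq> d \<longrightarrow> y $ j = x $ j)" if x: "x \<in> cbox a b" for d x
  proof -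
    obtain r where r: "r \<in> set (edge_tiles d)" "\<exists>y\<in>?f r. \<forall>j. j \<noteq> d \<longrightarrow> y $ j = x $ j"
      using line_meets_edge_tile[OF x] by blast
    obtain s t where st: "s \<in> set tiles" "t \<in> set tiles" "fst (side s d) = 0" "snd (side t d) = 6"
      "\<exists>y\<in>?f s. \<forall>j. j \<noteq> d \<longrightarrow> y $ j = x $ j" "\<exists>y\<in>?f t. \<forall>j. j \<noteq> d \<longrightarrow> y $ j = x $ j"
      using line_meets_end_tiles[OF x, of d] by blast
    have "s \<noteq> r" "t \<noteq> r" "s \<noteq> t"
      using st(3,4) edge_tile_inner[OF r(1)] tile_shape(4)[OF st(1), of d] by auto
    then have "?f s \<noteq> ?f r" "?f t \<noteq> ?f r" "?f s \<noteq> ?f t"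
      using st(1,2) r(1) edge_tiles_subset inj_on_tile_brick by (meson inj_on_eq_iff subsetD)+
    then show ?thesis
      using r st by blast
  qed
  ultimately obtain Q where Q: "piercing_partition (n + 2) Q (cbox a b)"
    "card Q = card (?P - (\<Union>d. ?E d)) + n * card (\<Union>d. ?E d)"
    using piercing_partition_by_slicing[OF brick_partition_tiles, of ?E n] assms edge_tiles_subset
    by (metis (no_types, lifting) image_mono)
  have E: "(\<Union>d. ?E d) = ?f ` (\<Union>d. set (edge_tiles d))" and sub: "(\<Union>d. set (edge_tiles d)) \<subseteq> set tiles"
    using edge_tiles_subset by auto
  have cE: "card (\<Union>d. ?E d) = 12"
    unfolding E using card_edge_tiles card_image[OF inj_on_subset[OF inj_on_tile_brick sub]] by simp
  have "card ?P = 21"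
    using card_image[OF inj_on_tile_brick] distinct_card[OF distinct_tiles(1)] distinct_tiles(2) by simp
  moreover have "(\<Union>d. ?E d) \<subseteq> ?P"
    unfolding E using sub by blast
  ultimately have "card (?P - (\<Union>d. ?E d)) = 9"
    using cE by (subst card_Diff_subset) (auto intro: finite_subset)
  then show ?thesis
    using Q cE by auto
qed

end

theorem theorem1p2:
  fixes k :: nat
  assumes "k \<ge> 3"
  shows "(\<forall>B :: (real ^ 3) set. brick B \<longrightarrow>
            (\<exists>P. piercing_partition k P B \<and> card P = 12 * k - 15)) \<and>
         piercing_number TYPE(3) k \<le> 12 * k - 15"
proof -
  have k: "0 < k - 2" "k - 2 + 2 = k" "9 + 12 * (k - 2) = 12 * k - 15"
    using assms by auto
  have existence: "\<exists>P. piercing_partition k P B \<and> card P = 12 * k - 15" if "brick B" for B :: "(real ^ 3) set"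
  proof -
    obtain a b where "\<And>i. a $ i < b $ i" "B = cbox a b"
      using \<open>brick B\<close> by (auto simp: brick_def)
    then show ?thesis
      using piercing_partition_cbox[of a b "k - 2"] k by auto
  qed
  have "brick (cbox 0 1 :: (real ^ 3) set)"
    unfolding brick_def by (intro exI[of _ 0] exI[of _ 1]) simp
  then have "piercing_number TYPE(3) k \<le> 12 * k - 15"
    unfolding piercing_number_def using existence by (intro Least_le) blast
  then show ?thesis
    using existence by blast
qed

end
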